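(* Let $G$ be a finite nonabelian simple group, $M$ a maximal subgroup of $G$, $g_0\in G\setminus M$, and let $\mathcal{D}=(\mathcal{P},\mathcal{B})$ be the $1$-design with $\mathcal{P}=\{M^g:g\in G\}$ and $\mathcal{B}=\{\Delta^g:g\in G\}$, where $\Delta=\{M^{g_0g}:g\in M\}$. Let $\phi\in\mathrm{Aut}(G)$. The following hold. (i) If $\phi(M)=M^x$ for some $x\in G$, then either $\widetilde\phi(\Delta)=\Delta^x$ or $\widetilde\phi(\Delta)\cap\Delta^x=\emptyset$. (ii) $\widetilde\phi\in\mathrm{Aut}(\mathcal{D})$ if and only if there exists $x\in G$ such that $\phi(M)=M^x$ and $\widetilde\phi(\Delta)=\Delta^x$.
   Context: For $x\in G$ and a subgroup $H\le G$, $H^x=x^{-1}Hx$; for a set $B$ of subgroups of $G$, $B^x=\{H^x:H\in B\}$. $\mathrm{Aut}(\mathcal{D})$ is the group of permutations of $\mathcal{P}$ that map blocks to blocks. For $\phi\in\mathrm{Aut}(G)$, $\widetilde\phi$ is the map defined by $\widetilde\phi(u):=\phi(u)$ for $u\in\mathcal{P}$ (the image of the subgroup $u$ under $\phi$) and $\widetilde\phi(B):=\{\phi(v):v\in B\}$ for subsets $B$ of $\mathcal{P}$. The statement $\widetilde\phi\in\mathrm{Aut}(\mathcal{D})$ means that $\widetilde\phi$ maps $\mathcal{P}$ onto $\mathcal{P}$ and maps blocks to blocks. *)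

theory Defs
  imports "HOL-Algebra.Algebra"
begin

definition maximal_subgroup :: "'a set \<Rightarrow> ('a, 'b) monoid_scheme \<Rightarrow> bool"
  where "maximal_subgroup M G \<longleftrightarrow>
    subgroup M G \<and> M \<noteq> carrier G \<and>
    (\<forall>H. subgroup H G \<and> M \<subseteq> H \<longrightarrow> H = M \<or> H = carrier G)"

(* Right-action convention: H^x = x^{-1} H x. *)
definition conj_subgroup :: "('a, 'b) monoid_scheme \<Rightarrow> 'a set \<Rightarrow> 'a \<Rightarrow> 'a set"
  where "conj_subgroup G H x = inv\<^bsub>G\<^esub> x <#\<^bsub>G\<^esub> H #>\<^bsub>G\<^esub> x"

definition conj_set :: "('a, 'b) monoid_scheme \<Rightarrow> 'a set set \<Rightarrow> 'a \<Rightarrow> 'a set set"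
  where "conj_set G B x = {conj_subgroup G H x |H. H \<in> B}"

(* Permutations of P are extensional bijections, as in the library's Bij. *)
definition design_auto :: "'p set \<times> 'p set set \<Rightarrow> ('p \<Rightarrow> 'p) set"
  where "design_auto D = {f \<in> Bij (fst D). \<forall>B \<in> snd D. f ` B \<in> snd D}"

(* The action on points (sets of group elements); its action on a set B of points
   is the image "induced \<phi> ` B". *)
definition induced :: "('a \<Rightarrow> 'a) \<Rightarrow> 'a set \<Rightarrow> 'a set"
  where "induced \<phi> u = \<phi> ` u"

(* For \<phi> an automorphism of G and P consisting of subsets of G, injectivity of
   induced \<phi> is automatic, so that membership in design_auto just says that P is
   mapped onto P and blocks to blocks. *)
lemma induced_in_design_auto_iff:
  assumes "\<phi> \<in> auto G"
    and "\<And>u. u \<in> P \<Longrightarrow> u \<subseteq> carrier G"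
    and "\<And>B. B \<in> \<B> \<Longrightarrow> B \<subseteq> P"
  shows "restrict (induced \<phi>) P \<in> design_auto (P, \<B>) \<longleftrightarrow>
    induced \<phi> ` P = P \<and> (\<forall>B \<in> \<B>. induced \<phi> ` B \<in> \<B>)"
proof -
  have inj: "inj_on \<phi> (carrier G)"
    using assms(1) by (auto simp: auto_def Bij_def bij_betw_def)
  have inj': "inj_on (induced \<phi>) P"
    unfolding induced_def using inj_on_image_eq_iff[OF inj] assms(2) by (meson inj_onI)
  have "restrict (induced \<phi>) P ` B = induced \<phi> ` B" if "B \<in> \<B>" for B
    using assms(3)[OF that] by (auto intro!: image_cong)
  then show ?thesis
    using inj' by (auto simp: design_auto_def Bij_def bij_betw_def)
qed

end

theory Submission
  imports Defs
begin

text \<open>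
  Everything happens inside two conjugation actions of \<open>G\<close>: on subsets of \<open>G\<close> (points) and on sets
  of such subsets (blocks). An automorphism \<open>\<phi>\<close> respects both up to a twist, \<open>\<phi>(H\<^sup>x) = \<phi>(H)\<^sup>y\<close> with
  \<open>y = \<phi>(x)\<close>, so it carries orbits to orbits and stabilizers to stabilizers.

  For (i), \<open>\<Delta>\<close> is the orbit of the point \<open>M\<^sup>g\<^sup>0\<close> under \<open>M\<close>. Hence \<open>\<phi>(\<Delta>)\<close> is an orbit of \<open>\<phi>(M)\<close>, while
  \<open>\<Delta>\<^sup>x\<close> is an orbit of \<open>M\<^sup>x\<close>. If these two groups agree, the orbits coincide or are disjoint.

  For (ii), the backward direction is the twisting rule. In the forward direction one only gets
  \<open>\<phi>(M) = M\<^sup>y\<close> and \<open>\<phi>(\<Delta>) = \<Delta>\<^sup>x\<close> with possibly different \<open>x\<close> and \<open>y\<close>. The stabilizer of \<open>\<Delta>\<close>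
  contains the maximal subgroup \<open>M\<close>, so it is \<open>G\<close> or \<open>M\<close>. If it is \<open>G\<close>, all translates of \<open>\<Delta>\<close> are equal
  and \<open>y\<close> serves for both. If it is \<open>M\<close>, comparing the stabilizers of both sides of
  \<open>\<phi>(\<Delta>) = \<Delta>\<^sup>x\<close> gives \<open>\<phi>(M) = M\<^sup>x\<close>, and \<open>x\<close> serves for both.
\<close>

section \<open>Conjugation of subsets and of sets of subsets\<close>

definition conj_orbit :: "('a, 'b) monoid_scheme \<Rightarrow> 'a set \<Rightarrow> 'a set \<Rightarrow> 'a set set"
  where "conj_orbit G A H = conj_subgroup G H ` A"

definition conj_stabilizer :: "('a, 'b) monoid_scheme \<Rightarrow> 'a set set \<Rightarrow> 'a set"
  where "conj_stabilizer G B = {g \<in> carrier G. conj_set G B g = B}"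

lemma conj_subgroup_eq_image:
  "conj_subgroup G H x = (\<lambda>h. inv\<^bsub>G\<^esub> x \<otimes>\<^bsub>G\<^esub> h \<otimes>\<^bsub>G\<^esub> x) ` H"
  by (auto simp: conj_subgroup_def l_coset_def r_coset_def)

lemma conj_set_eq_image: "conj_set G B x = (\<lambda>H. conj_subgroup G H x) ` B"
  by (auto simp: conj_set_def)

context group
begin

lemma conj_subgroup_closed:
  assumes "H \<subseteq> carrier G" "x \<in> carrier G"
  shows "conj_subgroup G H x \<subseteq> carrier G"
  using assms by (auto simp: conj_subgroup_eq_image)

lemma conj_subgroup_one:
  assumes "H \<subseteq> carrier G"
  shows "conj_subgroup G H \<one> = H"
proof -
  have "(\<lambda>h. inv \<one> \<otimes> h \<otimes> \<one>) ` H = (\<lambda>h. h) ` H"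
    using assms by (intro image_cong) auto
  then show ?thesis by (simp add: conj_subgroup_eq_image)
qed

lemma conj_subgroup_mult:
  assumes "H \<subseteq> carrier G" "x \<in> carrier G" "y \<in> carrier G"
  shows "conj_subgroup G (conj_subgroup G H x) y = conj_subgroup G H (x \<otimes> y)"
  unfolding conj_subgroup_eq_image image_image
  using assms by (intro image_cong) (auto simp: inv_mult_group m_assoc subset_iff)

lemma mem_conj_subgroup_iff:
  assumes "H \<subseteq> carrier G" "x \<in> carrier G" "g \<in> carrier G"
  shows "g \<in> conj_subgroup G H x \<longleftrightarrow> x \<otimes> g \<otimes> inv x \<in> H"
proof
  assume "g \<in> conj_subgroup G H x"
  then obtain h where "h \<in> H" "g = inv x \<otimes> h \<otimes> x"
    by (auto simp: conj_subgroup_eq_image)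
  moreover from this have "x \<otimes> g \<otimes> inv x = h"
    using assms by (auto simp: m_assoc subset_iff) (simp add: m_assoc[symmetric])
  ultimately show "x \<otimes> g \<otimes> inv x \<in> H" by simp
next
  assume "x \<otimes> g \<otimes> inv x \<in> H"
  moreover have "g = inv x \<otimes> (x \<otimes> g \<otimes> inv x) \<otimes> x"
    using assms by (simp add: m_assoc) (simp add: m_assoc[symmetric])
  ultimately show "g \<in> conj_subgroup G H x"
    unfolding conj_subgroup_eq_image by blast
qed

lemma conj_set_closed:
  assumes "B \<subseteq> Pow (carrier G)" "x \<in> carrier G"
  shows "conj_set G B x \<subseteq> Pow (carrier G)"
  unfolding conj_set_eq_image
  using assms by (intro image_subsetI PowI conj_subgroup_closed) auto

lemma conj_set_one:
  assumes "B \<subseteq> Pow (carrier G)"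
  shows "conj_set G B \<one> = B"
  using assms by (force simp: conj_set_eq_image conj_subgroup_one subset_iff)

lemma conj_set_mult:
  assumes "B \<subseteq> Pow (carrier G)" "x \<in> carrier G" "y \<in> carrier G"
  shows "conj_set G (conj_set G B x) y = conj_set G B (x \<otimes> y)"
  unfolding conj_set_eq_image image_image
  using assms by (intro image_cong) (auto simp: conj_subgroup_mult)

section \<open>Orbits\<close>

lemma conj_orbit_closed:
  assumes "H \<subseteq> carrier G" "A \<subseteq> carrier G"
  shows "conj_orbit G A H \<subseteq> Pow (carrier G)"
  unfolding conj_orbit_def
  using assms by (intro image_subsetI PowI conj_subgroup_closed) auto

text \<open>Left translation by \<open>a\<close> permutes \<open>A\<close>, so every point of an orbit generates all of it.\<close>

lemma conj_orbit_absorb: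
  assumes "subgroup A G" "H \<subseteq> carrier G" "a \<in> A"
  shows "conj_orbit G A (conj_subgroup G H a) = conj_orbit G A H"
proof -
  interpret A: subgroup A G by fact
  have translate: "(\<lambda>b. a \<otimes> b) ` A = A"
    using coset_join3[of a A] assms by (auto simp: l_coset_def)
  have "conj_orbit G A (conj_subgroup G H a) = conj_subgroup G H ` (\<lambda>b. a \<otimes> b) ` A"
    unfolding conj_orbit_def image_image
    using assms by (intro image_cong) (auto simp: conj_subgroup_mult)
  then show ?thesis by (simp only: translate conj_orbit_def)
qed

lemma conj_orbits_eq_or_disjoint:
  assumes "subgroup A G" "H \<subseteq> carrier G" "K \<subseteq> carrier G"
  shows "conj_orbit G A H = conj_orbit G A K \<or> conj_orbit G A H \<inter> conj_orbit G A K = {}"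
proof (rule disjCI)
  assume "conj_orbit G A H \<inter> conj_orbit G A K \<noteq> {}"
  then obtain a b where "a \<in> A" "b \<in> A" "conj_subgroup G H a = conj_subgroup G K b"
    by (auto simp: conj_orbit_def)
  then show "conj_orbit G A H = conj_orbit G A K"
    using conj_orbit_absorb assms by metis
qed

text \<open>This is the identity \<open>a x = x (x\<^sup>-\<^sup>1 a x)\<close>: conjugating by \<open>x\<close> turns the action of \<open>a\<close> into that
  of \<open>a\<^sup>x\<close>.\<close>

lemma conj_set_conj_orbit:
  assumes "A \<subseteq> carrier G" "H \<subseteq> carrier G" "x \<in> carrier G"
  shows "conj_set G (conj_orbit G A H) x
       = conj_orbit G (conj_subgroup G A x) (conj_subgroup G H x)"
  unfolding conj_orbit_def conj_set_eq_image conj_subgroup_eq_image[of G A] image_image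
proof (intro image_cong refl)
  fix a assume "a \<in> A"
  then have a: "a \<in> carrier G" using assms by blast
  have "x \<otimes> (inv x \<otimes> a \<otimes> x) = a \<otimes> x"
    using a assms by (simp add: m_assoc[symmetric])
  then show "conj_subgroup G (conj_subgroup G H a) x
      = conj_subgroup G (conj_subgroup G H x) (inv x \<otimes> a \<otimes> x)"
    using a assms by (simp add: conj_subgroup_mult)
qed

section \<open>Stabilizers\<close>

lemma subgroup_conj_stabilizer:
  assumes "B \<subseteq> Pow (carrier G)"
  shows "subgroup (conj_stabilizer G B) G"
proof (rule subgroupI)
  show "conj_stabilizer G B \<noteq> {}"
    using assms conj_set_one by (auto simp: conj_stabilizer_def)
next
  fix a assume "a \<in> conj_stabilizer G B"
  then have a: "a \<in> carrier G" "conj_set G B a = B"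
    by (auto simp: conj_stabilizer_def)
  then have "conj_set G B (inv a) = conj_set G (conj_set G B a) (inv a)" by simp
  also have "\<dots> = B" using a(1) assms by (simp add: conj_set_mult conj_set_one)
  finally show "inv a \<in> conj_stabilizer G B" using a by (simp add: conj_stabilizer_def)
next
  fix a b assume "a \<in> conj_stabilizer G B" "b \<in> conj_stabilizer G B"
  then show "a \<otimes> b \<in> conj_stabilizer G B"
    using assms by (auto simp: conj_stabilizer_def simp flip: conj_set_mult)
qed (auto simp: conj_stabilizer_def)

lemma conj_stabilizer_conj_set:
  assumes "B \<subseteq> Pow (carrier G)" "x \<in> carrier G"
  shows "conj_stabilizer G (conj_set G B x) = conj_subgroup G (conj_stabilizer G B) x"
proof -
  have S: "conj_stabilizer G B \<subseteq> carrier G" by (auto simp: conj_stabilizer_def)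
  have "conj_set G (conj_set G B x) g = conj_set G B x \<longleftrightarrow> conj_set G B (x \<otimes> g \<otimes> inv x) = B"
    if g: "g \<in> carrier G" for g
  proof
    assume "conj_set G (conj_set G B x) g = conj_set G B x"
    then have "conj_set G (conj_set G B (x \<otimes> g)) (inv x) = conj_set G (conj_set G B x) (inv x)"
      using g assms by (simp add: conj_set_mult)
    then show "conj_set G B (x \<otimes> g \<otimes> inv x) = B"
      using g assms by (simp add: conj_set_mult conj_set_one)
  next
    assume "conj_set G B (x \<otimes> g \<otimes> inv x) = B"
    then have "conj_set G B x = conj_set G (conj_set G B (x \<otimes> g \<otimes> inv x)) x" by simp
    also have "\<dots> = conj_set G (conj_set G B x) g"
      using g assms by (simp add: conj_set_mult m_assoc)
    finally show "conj_set G (conj_set G B x) g = conj_set G B x" by simp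
  qed
  then have "g \<in> conj_stabilizer G (conj_set G B x)
      \<longleftrightarrow> g \<in> conj_subgroup G (conj_stabilizer G B) x" if "g \<in> carrier G" for g
    using that assms by (simp add: mem_conj_subgroup_iff[OF S]) (simp add: conj_stabilizer_def)
  moreover have "conj_subgroup G (conj_stabilizer G B) x \<subseteq> carrier G"
    using conj_subgroup_closed[OF S] assms by simp
  ultimately show ?thesis by (auto simp: conj_stabilizer_def)
qed

lemma conj_set_conj_orbit_absorb:
  assumes "subgroup A G" "H \<subseteq> carrier G" "a \<in> A"
  shows "conj_set G (conj_orbit G A H) a = conj_orbit G A H"
proof -
  interpret A: subgroup A G by fact
  have "conj_subgroup G A a = A"
    using assms A.rcos_const coset_join3[of "inv a" A]
    by (simp add: conj_subgroup_def)
  then show ?thesis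
    using assms by (simp add: conj_set_conj_orbit A.subset conj_orbit_absorb)
qed

lemma subset_conj_stabilizer_conj_orbit:
  assumes "subgroup A G" "H \<subseteq> carrier G"
  shows "A \<subseteq> conj_stabilizer G (conj_orbit G A H)"
  using assms conj_set_conj_orbit_absorb subgroup.subset[OF assms(1)]
  by (auto simp: conj_stabilizer_def)

section \<open>Automorphisms and the conjugation action\<close>

lemma auto_inj_on: "\<phi> \<in> auto G \<Longrightarrow> inj_on \<phi> (carrier G)"
  by (auto simp: auto_def Bij_def bij_betw_def)

lemma auto_image_carrier: "\<phi> \<in> auto G \<Longrightarrow> \<phi> ` carrier G = carrier G"
  by (auto simp: auto_def Bij_def bij_betw_def)

lemma auto_group_hom: "\<phi> \<in> auto G \<Longrightarrow> group_hom G G \<phi>"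
  by (auto simp: auto_def group_hom_def group_hom_axioms_def is_group)

lemma auto_image_conj_subgroup:
  assumes "\<phi> \<in> auto G" "H \<subseteq> carrier G" "x \<in> carrier G"
  shows "\<phi> ` conj_subgroup G H x = conj_subgroup G (\<phi> ` H) (\<phi> x)"
proof -
  interpret group_hom G G \<phi> using auto_group_hom[OF assms(1)] .
  show ?thesis
    unfolding conj_subgroup_eq_image image_image
    using assms by (intro image_cong) (auto simp: subset_iff)
qed

lemma induced_image_conj_set:
  assumes "\<phi> \<in> auto G" "B \<subseteq> Pow (carrier G)" "x \<in> carrier G"
  shows "induced \<phi> ` conj_set G B x = conj_set G (induced \<phi> ` B) (\<phi> x)"
  unfolding conj_set_eq_image image_image induced_def
  by (intro image_cong refl auto_image_conj_subgroup[OF assms(1)]) (use assms in auto)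

lemma induced_image_conj_orbit:
  assumes "\<phi> \<in> auto G" "A \<subseteq> carrier G" "H \<subseteq> carrier G"
  shows "induced \<phi> ` conj_orbit G A H = conj_orbit G (\<phi> ` A) (\<phi> ` H)"
  unfolding conj_orbit_def image_image induced_def
  by (intro image_cong refl auto_image_conj_subgroup[OF assms(1)]) (use assms in auto)

lemma conj_stabilizer_induced_image:
  assumes "\<phi> \<in> auto G" "B \<subseteq> Pow (carrier G)"
  shows "conj_stabilizer G (induced \<phi> ` B) = \<phi> ` conj_stabilizer G B"
proof -
  have inj: "inj_on (induced \<phi>) (Pow (carrier G))"
    unfolding induced_def using auto_inj_on[OF assms(1)] by (rule inj_on_image_Pow)
  have "conj_set G (induced \<phi> ` B) (\<phi> g) = induced \<phi> ` B \<longleftrightarrow> conj_set G B g = B"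
    if "g \<in> carrier G" for g
    using inj_on_image_eq_iff[OF inj conj_set_closed[OF assms(2) that] assms(2)]
      induced_image_conj_set[OF assms that] by simp
  then have "{g \<in> \<phi> ` carrier G. conj_set G (induced \<phi> ` B) g = induced \<phi> ` B}
      = \<phi> ` {g \<in> carrier G. conj_set G B g = B}" by auto
  then show ?thesis
    by (simp add: conj_stabilizer_def auto_image_carrier[OF assms(1)])
qed

section \<open>Automorphisms acting on the design\<close>

text \<open>The two conjugating elements may be found separately, because \<open>B\<close> either determines \<open>M\<close> as its
  stabilizer or, by maximality of \<open>M\<close>, is fixed by all of \<open>G\<close>.\<close>

lemma common_conjugator:
  assumes auto: "\<phi> \<in> auto G" and max: "maximal_subgroup M G"
    and B: "B \<subseteq> Pow (carrier G)" "M \<subseteq> conj_stabilizer G B"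
    and x: "x \<in> carrier G" "induced \<phi> ` B = conj_set G B x"
    and y: "y \<in> carrier G" "\<phi> ` M = conj_subgroup G M y"
  shows "\<exists>z \<in> carrier G. \<phi> ` M = conj_subgroup G M z \<and> induced \<phi> ` B = conj_set G B z"
proof -
  consider "conj_stabilizer G B = M" | "conj_stabilizer G B = carrier G"
    using max B subgroup_conj_stabilizer unfolding maximal_subgroup_def by blast
  then show ?thesis
  proof cases
    case 1
    have "\<phi> ` M = conj_stabilizer G (induced \<phi> ` B)"
      using conj_stabilizer_induced_image[OF auto B(1)] 1 by simp
    also have "\<dots> = conj_subgroup G M x"
      using conj_stabilizer_conj_set[OF B(1) x(1)] x(2) 1 by simp
    finally show ?thesis using x by blast
  next
    case 2
    then have "conj_set G B x = conj_set G B y"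
      using x(1) y(1) by (auto simp: conj_stabilizer_def)
    then show ?thesis using x y by auto
  qed
qed

end

theorem lemma3p1:
  fixes G :: "('a, 'b) monoid_scheme" (structure)
    and M :: "'a set" and g0 :: 'a and \<phi> :: "'a \<Rightarrow> 'a"
    and \<Delta> \<P> :: "'a set set" and \<B> :: "'a set set set"
  assumes "simple_group G" and "finite (carrier G)" and "\<not> comm_group G"
    and "maximal_subgroup M G"
    and "g0 \<in> carrier G - M"
    and "\<P> = {conj_subgroup G M g |g. g \<in> carrier G}"
    and "\<Delta> = {conj_subgroup G M (g0 \<otimes> g) |g. g \<in> M}"
    and "\<B> = {conj_set G \<Delta> g |g. g \<in> carrier G}"
    and "\<phi> \<in> auto G"
  shows "(\<forall>x \<in> carrier G. \<phi> ` M = conj_subgroup G M x \<longrightarrow>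
            induced \<phi> ` \<Delta> = conj_set G \<Delta> x \<or>
            induced \<phi> ` \<Delta> \<inter> conj_set G \<Delta> x = {}) \<and>
         (restrict (induced \<phi>) \<P> \<in> design_auto (\<P>, \<B>) \<longleftrightarrow>
            (\<exists>x \<in> carrier G. \<phi> ` M = conj_subgroup G M x \<and>
              induced \<phi> ` \<Delta> = conj_set G \<Delta> x))"
proof -
  interpret group G using assms(1) by (simp add: simple_group_def)
  note \<phi> = \<open>\<phi> \<in> auto G\<close>
  interpret \<phi>: group_hom G G \<phi> using auto_group_hom[OF \<phi>] .
  have subM: "subgroup M G" using assms(4) by (simp add: maximal_subgroup_def)
  have M: "M \<subseteq> carrier G" using subgroup.subset[OF subM] .
  have g0: "g0 \<in> carrier G" using assms(5) by simp
  define N where "N = conj_subgroup G M g0"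
  have N: "N \<subseteq> carrier G" unfolding N_def using conj_subgroup_closed[OF M g0] .
  have \<P>: "\<P> = conj_orbit G (carrier G) M"
    using assms(6) by (auto simp: conj_orbit_def)
  have \<B>: "\<B> = conj_set G \<Delta> ` carrier G"
    unfolding assms(8) by auto
  have \<Delta>: "\<Delta> = conj_orbit G M N"
  proof -
    have "conj_subgroup G N g = conj_subgroup G M (g0 \<otimes> g)" if "g \<in> M" for g
      unfolding N_def using conj_subgroup_mult M g0 that by blast
    then show ?thesis unfolding assms(7) conj_orbit_def by blast
  qed
  have \<Delta>_closed: "\<Delta> \<subseteq> Pow (carrier G)"
    unfolding \<Delta> using conj_orbit_closed[OF N M] .
  have \<Delta>_stab: "M \<subseteq> conj_stabilizer G \<Delta>"
    unfolding \<Delta> using subset_conj_stabilizer_conj_orbit[OF subM N] .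
  have \<P>_closed: "\<P> \<subseteq> Pow (carrier G)"
    unfolding \<P> using conj_orbit_closed[OF M] by simp
  have block_sub: "B \<subseteq> \<P>" if B_in: "B \<in> \<B>" for B
  proof -
    obtain g where g: "g \<in> carrier G" and B: "B = conj_set G \<Delta> g"
      using B_in unfolding \<B> by auto
    have "conj_subgroup G (conj_subgroup G M (g0 \<otimes> m)) g \<in> \<P>" if "m \<in> M" for m
    proof -
      have "m \<in> carrier G" using that M by blast
      then show ?thesis using g g0 by (simp add: \<P> conj_orbit_def conj_subgroup_mult[OF M])
    qed
    then show ?thesis by (auto simp: B conj_set_eq_image assms(7))
  qed
  have mem_design_auto: "restrict (induced \<phi>) \<P> \<in> design_auto (\<P>, \<B>) \<longleftrightarrow>
      induced \<phi> ` \<P> = \<P> \<and> (\<forall>B \<in> \<B>. induced \<phi> ` B \<in> \<B>)"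
    by (rule induced_in_design_auto_iff[OF \<phi>]) (use \<P>_closed block_sub in auto)

  have part1: "induced \<phi> ` \<Delta> = conj_set G \<Delta> x \<or> induced \<phi> ` \<Delta> \<inter> conj_set G \<Delta> x = {}"
    if x: "x \<in> carrier G" and eq: "\<phi> ` M = conj_subgroup G M x" for x
  proof -
    have "induced \<phi> ` \<Delta> = conj_orbit G (\<phi> ` M) (\<phi> ` N)"
      unfolding \<Delta> using induced_image_conj_orbit[OF \<phi> M N] .
    moreover have "conj_set G \<Delta> x = conj_orbit G (\<phi> ` M) (conj_subgroup G N x)"
      unfolding \<Delta> eq using conj_set_conj_orbit[OF M N x] .
    moreover have "subgroup (\<phi> ` M) G"
      using \<phi>.subgroup_img_is_subgroup[OF subM] .
    moreover have "\<phi> ` N \<subseteq> carrier G" using N by auto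
    ultimately show ?thesis
      using conj_orbits_eq_or_disjoint conj_subgroup_closed[OF N x] by simp
  qed

  have backward: "restrict (induced \<phi>) \<P> \<in> design_auto (\<P>, \<B>)"
    if x: "x \<in> carrier G" and eqM: "\<phi> ` M = conj_subgroup G M x"
      and eq\<Delta>: "induced \<phi> ` \<Delta> = conj_set G \<Delta> x" for x
  proof -
    have "induced \<phi> ` \<P> = conj_orbit G (carrier G) (conj_subgroup G M x)"
      unfolding \<P> eqM[symmetric]
      by (simp add: induced_image_conj_orbit[OF \<phi> _ M] auto_image_carrier[OF \<phi>])
    also have "\<dots> = \<P>"
      unfolding \<P> using conj_orbit_absorb[OF subgroup_self M x] .
    finally have "induced \<phi> ` \<P> = \<P>" .
    moreover have "induced \<phi> ` B \<in> \<B>" if B_in: "B \<in> \<B>" for B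
    proof -
      obtain g where g: "g \<in> carrier G" and B: "B = conj_set G \<Delta> g"
        using B_in unfolding \<B> by auto
      have "induced \<phi> ` B = conj_set G \<Delta> (x \<otimes> \<phi> g)"
        using g x by (simp add: B induced_image_conj_set[OF \<phi> \<Delta>_closed] eq\<Delta>
            conj_set_mult[OF \<Delta>_closed])
      then show ?thesis unfolding \<B> using g x by auto
    qed
    ultimately show ?thesis using mem_design_auto by blast
  qed

  have forward: "\<exists>x \<in> carrier G. \<phi> ` M = conj_subgroup G M x \<and> induced \<phi> ` \<Delta> = conj_set G \<Delta> x"
    if "restrict (induced \<phi>) \<P> \<in> design_auto (\<P>, \<B>)"
  proof -
    have "M \<in> \<P>"
      unfolding \<P> conj_orbit_def using conj_subgroup_one[OF M] one_closed by (metis imageI)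
    moreover have "\<Delta> \<in> \<B>"
      unfolding \<B> using conj_set_one[OF \<Delta>_closed] one_closed by (metis imageI)
    ultimately have "\<phi> ` M \<in> \<P>" "induced \<phi> ` \<Delta> \<in> \<B>"
      using that mem_design_auto unfolding induced_def by blast+
    then obtain x y where x: "x \<in> carrier G" "induced \<phi> ` \<Delta> = conj_set G \<Delta> x"
      and y: "y \<in> carrier G" "\<phi> ` M = conj_subgroup G M y"
      unfolding \<P> \<B> conj_orbit_def by auto
    show ?thesis
      by (rule common_conjugator[OF \<phi> assms(4) \<Delta>_closed \<Delta>_stab x y])
  qed

  have "restrict (induced \<phi>) \<P> \<in> design_auto (\<P>, \<B>) \<longleftrightarrow>
      (\<exists>x \<in> carrier G. \<phi> ` M = conj_subgroup G M x \<and> induced \<phi> ` \<Delta> = conj_set G \<Delta> x)"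
    by (rule iffI, erule forward, elim bexE conjE, rule backward)
  then show ?thesis
    by (intro conjI ballI impI part1)
qed

end
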